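(* Let $A$ be a separable C*-algebra and let $B\subseteq A$ be a closed *-subalgebra such that (i) $B$ contains an approximate unit for $A$; (ii) the range of every virtual commutant of $B$ in $A$ is contained in $B$; and (iii) the normalizer $N(B)=\{a\in A: a^*Ba\subseteq B,\ aBa^*\subseteq B\}$ generates $A$ as a C*-algebra. Then there exists at most one conditional expectation from $A$ onto $B$.
   Context: A virtual commutant of $B$ in $A$ is a linear map $\varphi:J\to A$, where $J$ is a closed two-sided ideal of $B$, such that $\varphi(bx)=b\varphi(x)$ and $\varphi(xb)=\varphi(x)b$ for all $x\in J$ and $b\in B$. (Since $N(B)$ is closed under products and adjoints, generating $A$ as a C*-algebra is the same as having dense linear span in $A$.) *)

theory Defs
  imports "HOL-Analysis.Analysis"
begin

text \<open>
  C*-algebras over the complex numbers, not necessarily unital. The norm, its completeness and its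
  submultiplicativity come from the library classes; the real scalar multiplication is required to
  be the restriction of the complex one.
\<close>

class cstar_algebra = real_normed_algebra + complete_space +
  fixes scaleC :: "complex \<Rightarrow> 'a \<Rightarrow> 'a"  (infixr "*\<^sub>C" 75)
    and star :: "'a \<Rightarrow> 'a"
  assumes scaleC_add_right: "a *\<^sub>C (x + y) = a *\<^sub>C x + a *\<^sub>C y"
    and scaleC_add_left: "(a + b) *\<^sub>C x = a *\<^sub>C x + b *\<^sub>C x"
    and scaleC_scaleC: "a *\<^sub>C (b *\<^sub>C x) = (a * b) *\<^sub>C x"
    and scaleR_scaleC: "r *\<^sub>R x = complex_of_real r *\<^sub>C x"
    and norm_scaleC: "norm (a *\<^sub>C x) = cmod a * norm x"
    and mult_scaleC_left: "(a *\<^sub>C x) * y = a *\<^sub>C (x * y)"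
    and mult_scaleC_right: "x * (a *\<^sub>C y) = a *\<^sub>C (x * y)"
    and star_star: "star (star x) = x"
    and star_add: "star (x + y) = star x + star y"
    and star_scaleC: "star (a *\<^sub>C x) = cnj a *\<^sub>C star x"
    and star_mult: "star (x * y) = star y * star x"
    and cstar_identity: "norm (star x * x) = (norm x)\<^sup>2"

interpretation complex_vector: vector_space "scaleC :: complex \<Rightarrow> 'a \<Rightarrow> 'a::cstar_algebra"
proof
  fix x :: 'a
  have "(1::complex) *\<^sub>C x = (1::real) *\<^sub>R x"
    by (simp only: scaleR_scaleC of_real_1)
  then show "(1::complex) *\<^sub>C x = x"
    by simp
qed (simp_all add: scaleC_add_right scaleC_add_left scaleC_scaleC)

definition closed_star_subalgebra :: "'a::cstar_algebra set \<Rightarrow> bool" where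
  "closed_star_subalgebra B \<longleftrightarrow>
     complex_vector.subspace B \<and> closed B \<and>
     (\<forall>x\<in>B. \<forall>y\<in>B. x * y \<in> B) \<and> (\<forall>x\<in>B. star x \<in> B)"

definition closed_ideal :: "'a::cstar_algebra set \<Rightarrow> 'a set \<Rightarrow> bool" where
  "closed_ideal B J \<longleftrightarrow>
     J \<subseteq> B \<and> complex_vector.subspace J \<and> closed J \<and>
     (\<forall>b\<in>B. \<forall>x\<in>J. b * x \<in> J \<and> x * b \<in> J)"

text \<open>
  A linear map from \<open>J\<close> to the whole algebra is encoded as a function on the type of which only the
  values on \<open>J\<close> matter.
\<close>

definition virtual_commutant :: "'a::cstar_algebra set \<Rightarrow> 'a set \<Rightarrow> ('a \<Rightarrow> 'a) \<Rightarrow> bool" where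
  "virtual_commutant B J \<phi> \<longleftrightarrow>
     closed_ideal B J \<and>
     (\<forall>x\<in>J. \<forall>y\<in>J. \<phi> (x + y) = \<phi> x + \<phi> y) \<and>
     (\<forall>c. \<forall>x\<in>J. \<phi> (c *\<^sub>C x) = c *\<^sub>C \<phi> x) \<and>
     (\<forall>b\<in>B. \<forall>x\<in>J. \<phi> (b * x) = b * \<phi> x \<and> \<phi> (x * b) = \<phi> x * b)"

text \<open>
  Nets are represented by filters: a net in \<open>B\<close> gives the filter generated by the images of its
  tails, and every proper filter containing \<open>B\<close> arises in this way. Neither boundedness nor
  positivity nor monotonicity of the net is demanded, so every convention for approximate units in
  the literature is covered.
\<close>

definition contains_approximate_unit :: "'a::cstar_algebra set \<Rightarrow> bool" where
  "contains_approximate_unit B \<longleftrightarrow>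
     (\<exists>F. F \<noteq> bot \<and> (\<forall>\<^sub>F e in F. e \<in> B) \<and>
       (\<forall>a. ((\<lambda>e. e * a) \<longlongrightarrow> a) F \<and> ((\<lambda>e. a * e) \<longlongrightarrow> a) F))"

definition normalizer :: "'a::cstar_algebra set \<Rightarrow> 'a set" where
  "normalizer B =
     {a. (\<lambda>b. star a * b * a) ` B \<subseteq> B \<and> (\<lambda>b. a * b * star a) ` B \<subseteq> B}"

definition generates :: "'a::cstar_algebra set \<Rightarrow> bool" where
  "generates S \<longleftrightarrow> closed_star_subalgebra hull S = UNIV"

definition positive_in :: "'a::cstar_algebra set \<Rightarrow> 'a \<Rightarrow> bool" where
  "positive_in B x \<longleftrightarrow> (\<exists>y\<in>B. x = star y * y)"

text \<open>
  A conditional expectation onto \<open>B\<close> is a positive, contractive, idempotent linear map with range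
  \<open>B\<close> that is a \<open>B\<close>-bimodule map; the first two clauses after linearity express that it is
  idempotent with range \<open>B\<close>.
\<close>

definition conditional_expectation :: "'a::cstar_algebra set \<Rightarrow> ('a \<Rightarrow> 'a) \<Rightarrow> bool" where
  "conditional_expectation B E \<longleftrightarrow>
     Vector_Spaces.linear scaleC scaleC E \<and>
     range E \<subseteq> B \<and> (\<forall>b\<in>B. E b = b) \<and>
     (\<forall>a. positive_in UNIV a \<longrightarrow> positive_in B (E a)) \<and>
     (\<forall>a. norm (E a) \<le> norm a) \<and>
     (\<forall>b\<in>B. \<forall>a. E (b * a) = b * E a \<and> E (a * b) = E a * b)"

end

theory Submission
  imports Defs
begin

text \<open>
  Let \<open>E\<close> be a conditional expectation and \<open>a\<close> a normalizer. On the closed ideal of \<open>B\<close> generated by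
  \<open>a B a\<^sup>*\<close>, the assignment \<open>\<Sum> b\<^sub>i a c\<^sub>i a\<^sup>* d\<^sub>i \<mapsto> \<Sum> b\<^sub>i a c\<^sub>i E(a\<^sup>*) d\<^sub>i\<close> is a well-defined contraction:
  if it sends \<open>x\<close> to \<open>s\<close>, then \<open>s\<^sup>* s = E (s\<^sup>* x)\<close>, so \<open>\<parallel>s\<parallel>\<^sup>2 \<le> \<parallel>s\<parallel> \<parallel>x\<parallel>\<close>. It is a virtual commutant,
  whence \<open>a E(a\<^sup>*) \<in> B\<close> by means of the approximate unit. For a second conditional expectation \<open>F\<close>
  this yields \<open>E(a) E(a\<^sup>*) = a E(a\<^sup>*) = F(a) E(a\<^sup>*)\<close> and \<open>F(a) F(a\<^sup>*) = a F(a\<^sup>*) = E(a) F(a\<^sup>*)\<close>. Hence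
  \<open>(E(a) - F(a)) (E(a) - F(a))\<^sup>* = 0\<close>, and \<open>E\<close> and \<open>F\<close> agree on the normalizers, whose span is dense.
\<close>

section \<open>The involution and closures\<close>

lemma star_zero [simp]: "star (0::'a::cstar_algebra) = 0"
  using star_scaleC[of 0 "0::'a"] by simp

lemma star_minus: "star (- x) = - star (x::'a::cstar_algebra)"
  using star_scaleC[of "-1" x] by simp

lemma star_diff: "star (x - y) = star x - star (y::'a::cstar_algebra)"
  using star_add[of x "-y"] by (simp add: star_minus)

lemma norm_star_le: "norm x \<le> norm (star (x::'a::cstar_algebra))"
proof (cases "x = 0")
  case False
  have "norm x * norm x \<le> norm (star x) * norm x"
    using cstar_identity[of x] norm_mult_ineq[of "star x" x] by (simp add: power2_eq_square)
  then show ?thesis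
    using False by simp
qed simp

lemma norm_star [simp]: "norm (star x) = norm (x::'a::cstar_algebra)"
  using norm_star_le[of x] norm_star_le[of "star x"] by (simp add: star_star)

lemma star_mult_self_eq_zero_iff: "star x * x = 0 \<longleftrightarrow> (x::'a::cstar_algebra) = 0"
  using cstar_identity[of x] by auto

lemma bounded_linear_star: "bounded_linear (star :: 'a::cstar_algebra \<Rightarrow> 'a)"
  by (rule bounded_linear_intro[where K = 1])
    (simp_all add: star_add scaleR_scaleC star_scaleC)

lemma bounded_linear_scaleC: "bounded_linear (\<lambda>x::'a::cstar_algebra. c *\<^sub>C x)"
  by (rule bounded_linear_intro[where K = "cmod c"])
    (simp_all add: scaleC_add_right scaleR_scaleC scaleC_scaleC norm_scaleC mult.commute)

lemmas continuous_on_star [continuous_intros] =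
  bounded_linear.continuous_on[OF bounded_linear_star]
lemmas continuous_on_scaleC [continuous_intros] =
  bounded_linear.continuous_on[OF bounded_linear_scaleC]

lemma map_in_closure:
  assumes "continuous_on UNIV f" "\<And>x. x \<in> S \<Longrightarrow> f x \<in> T" "x \<in> closure S"
  shows "f x \<in> closure T"
proof -
  have "f ` closure S \<subseteq> closure T"
    using assms closure_subset
    by (intro image_closure_subset) (auto intro: continuous_on_subset)
  then show ?thesis
    using assms(3) by blast
qed

text \<open>The pair is treated as one point of the product space, where the closure of
  \<open>S \<times> S\<close> is the square of the closure of \<open>S\<close>.\<close>

lemma binop_in_closure:
  assumes "continuous_on UNIV (\<lambda>p. f (fst p) (snd p))"
    and "\<And>x y. x \<in> S \<Longrightarrow> y \<in> S \<Longrightarrow> f x y \<in> S" "x \<in> closure S" "y \<in> closure S"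
  shows "f x y \<in> closure S"
  using map_in_closure[OF assms(1), of "S \<times> S" S "(x, y)"] assms(2-) by (auto simp: closure_Times)

section \<open>The star algebra generated by the normalizers\<close>

lemma normalizerI:
  assumes "\<And>b. b \<in> B \<Longrightarrow> star a * b * a \<in> B" "\<And>b. b \<in> B \<Longrightarrow> a * b * star a \<in> B"
  shows "a \<in> normalizer B"
  using assms by (auto simp: normalizer_def)

lemma normalizerD:
  assumes "a \<in> normalizer B" "b \<in> B"
  shows "star a * b * a \<in> B" "a * b * star a \<in> B"
  using assms by (auto simp: normalizer_def)

lemma star_normalizer: "a \<in> normalizer B \<Longrightarrow> star a \<in> normalizer B"
  by (rule normalizerI) (simp_all add: star_star normalizerD)

lemma mult_normalizer:
  assumes x: "x \<in> normalizer B" and y: "y \<in> normalizer B"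
  shows "x * y \<in> normalizer B"
proof (rule normalizerI)
  fix b assume "b \<in> B"
  then have "star y * (star x * b * x) * y \<in> B" "x * (y * b * star y) * star x \<in> B"
    using normalizerD[OF x] normalizerD[OF y] by auto
  then show "star (x * y) * b * (x * y) \<in> B" "x * y * b * star (x * y) \<in> B"
    by (simp_all add: star_mult mult.assoc)
qed

text \<open>Span induction in one factor at a time makes the span a star algebra; continuity of the
  operations carries this over to the closure.\<close>

lemma closed_star_subalgebra_closure_span:
  fixes S :: "'a::cstar_algebra set"
  assumes mult: "\<And>x y. x \<in> S \<Longrightarrow> y \<in> S \<Longrightarrow> x * y \<in> S" and star: "\<And>x. x \<in> S \<Longrightarrow> star x \<in> S"
  shows "closed_star_subalgebra (closure (complex_vector.span S))"
proof -
  let ?V = "complex_vector.span S"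
  have left: "x * y \<in> ?V" if "x \<in> S" "y \<in> ?V" for x y
    using that(2)
    by (induct rule: complex_vector.span_induct_alt)
      (auto simp: distrib_left mult_scaleC_right complex_vector.span_zero
        intro!: complex_vector.span_add complex_vector.span_scale
        complex_vector.span_base[OF mult[OF that(1)]])
  have mult_V: "x * y \<in> ?V" if "x \<in> ?V" "y \<in> ?V" for x y
    using that(1)
    by (induct rule: complex_vector.span_induct_alt)
      (auto simp: distrib_right mult_scaleC_left complex_vector.span_zero
        intro!: complex_vector.span_add complex_vector.span_scale left that(2))
  have star_V: "star x \<in> ?V" if "x \<in> ?V" for x
    using that
    by (induct rule: complex_vector.span_induct_alt)
      (auto simp: star_add star_scaleC complex_vector.span_zero
        intro!: complex_vector.span_add complex_vector.span_scale
        complex_vector.span_base[OF star])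
  have "0 \<in> closure ?V"
    using closure_subset complex_vector.span_zero by blast
  moreover have "x + y \<in> closure ?V" if "x \<in> closure ?V" "y \<in> closure ?V" for x y
    using that
    by (rule binop_in_closure[rotated 2])
      (auto intro!: continuous_intros complex_vector.span_add)
  moreover have "x * y \<in> closure ?V" if "x \<in> closure ?V" "y \<in> closure ?V" for x y
    using that by (rule binop_in_closure[rotated 2]) (auto intro!: continuous_intros mult_V)
  moreover have "c *\<^sub>C x \<in> closure ?V" if "x \<in> closure ?V" for c x
    using that
    by (rule map_in_closure[rotated 2])
      (auto intro!: continuous_intros complex_vector.span_scale)
  moreover have "star x \<in> closure ?V" if "x \<in> closure ?V" for x
    using that by (rule map_in_closure[rotated 2]) (auto intro!: continuous_intros star_V)
  ultimately show ?thesis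
    by (simp add: closed_star_subalgebra_def complex_vector.subspace_def)
qed

text \<open>Normalizers are closed under products and adjoints, so their linear combinations are
  already dense.\<close>

lemma generates_normalizer_imp_dense:
  assumes "generates (normalizer B)"
  shows "closure (complex_vector.span (normalizer B)) = UNIV"
proof -
  have "closed_star_subalgebra hull normalizer B \<subseteq> closure (complex_vector.span (normalizer B))"
    using closure_subset complex_vector.span_base
    by (intro hull_minimal closed_star_subalgebra_closure_span)
      (blast intro: star_normalizer mult_normalizer)+
  then show ?thesis
    using assms by (auto simp: generates_def)
qed

section \<open>Subalgebras containing an approximate unit\<close>

locale nondegenerate_subalgebra =
  fixes B :: "'a::cstar_algebra set"
  assumes subalgebra: "closed_star_subalgebra B"
    and approximate_unit: "contains_approximate_unit B"
begin

lemma zero_mem: "0 \<in> B"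
  and add_mem: "x \<in> B \<Longrightarrow> y \<in> B \<Longrightarrow> x + y \<in> B"
  and scaleC_mem: "x \<in> B \<Longrightarrow> c *\<^sub>C x \<in> B"
  and mult_mem: "x \<in> B \<Longrightarrow> y \<in> B \<Longrightarrow> x * y \<in> B"
  and star_mem: "x \<in> B \<Longrightarrow> star x \<in> B"
  and closed_B: "closed B"
  using subalgebra by (auto simp: closed_star_subalgebra_def complex_vector.subspace_def)

lemma approximate_unit_filter:
  obtains F where "F \<noteq> bot" "\<forall>\<^sub>F e in F. e \<in> B"
    "\<And>x. ((\<lambda>e. e * x) \<longlongrightarrow> x) F" "\<And>x. ((\<lambda>e. x * e) \<longlongrightarrow> x) F"
  using approximate_unit unfolding contains_approximate_unit_def by blast

text \<open>The approximate unit replaces \<open>d\<close>, then \<open>c\<close>, then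
  \<open>b\<close>; each limit stays in the closed set \<open>B\<close>.\<close>

lemma mult_mem_if_sandwich_mem:
  assumes "\<And>b c d. b \<in> B \<Longrightarrow> c \<in> B \<Longrightarrow> d \<in> B \<Longrightarrow> b * x * c * y * d \<in> B"
  shows "x * y \<in> B"
proof -
  obtain F where F: "F \<noteq> bot" "\<forall>\<^sub>F e in F. e \<in> B"
      "\<And>x. ((\<lambda>e. e * x) \<longlongrightarrow> x) F" "\<And>x. ((\<lambda>e. x * e) \<longlongrightarrow> x) F"
    by (rule approximate_unit_filter) (rule that)
  have limit_mem: "z \<in> B" if "\<And>e. e \<in> B \<Longrightarrow> f e \<in> B" "(f \<longlongrightarrow> z) F" for f z
    by (rule Lim_in_closed_set[OF closed_B eventually_mono[OF F(2) that(1)] F(1) that(2)])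
  have 1: "b * x * c * y \<in> B" if "b \<in> B" "c \<in> B" for b c
    by (rule limit_mem[OF assms[OF that] F(4)])
  have 2: "b * x * y \<in> B" if "b \<in> B" for b
    by (rule limit_mem[OF 1[OF that] tendsto_mult[OF F(4) tendsto_const]])
  show ?thesis
    by (rule limit_mem[OF 2 tendsto_mult[OF F(3) tendsto_const]])
qed

lemma eq_if_mult_right_eq:
  assumes "\<And>b. b \<in> B \<Longrightarrow> x * b = y * b"
  shows "x = y"
proof -
  obtain F where F: "F \<noteq> bot" "\<forall>\<^sub>F e in F. e \<in> B"
      "\<And>x. ((\<lambda>e. e * x) \<longlongrightarrow> x) F" "\<And>x. ((\<lambda>e. x * e) \<longlongrightarrow> x) F"
    by (rule approximate_unit_filter) (rule that)
  have "((\<lambda>e. x * e) \<longlongrightarrow> y) F"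
    by (rule Lim_transform_eventually[OF F(4)[of y] eventually_mono[OF F(2)]])
      (simp add: assms)
  then show ?thesis
    using tendsto_unique[OF F(1) F(4)[of x]] by simp
qed

end

section \<open>Conditional expectations: linearity, continuity and the involution\<close>

locale expectation = nondegenerate_subalgebra B for B :: "'a::cstar_algebra set" +
  fixes E :: "'a \<Rightarrow> 'a"
  assumes expectation: "conditional_expectation B E"
begin

lemma linear_E: "Vector_Spaces.linear scaleC scaleC E"
  and E_mem: "E x \<in> B"
  and E_ident: "b \<in> B \<Longrightarrow> E b = b"
  and E_positive: "positive_in UNIV x \<Longrightarrow> positive_in B (E x)"
  and norm_E_le: "norm (E x) \<le> norm x"
  and E_mult_left: "b \<in> B \<Longrightarrow> E (b * x) = b * E x"
  and E_mult_right: "b \<in> B \<Longrightarrow> E (x * b) = E x * b"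
  using expectation by (auto simp: conditional_expectation_def)

lemmas E_add = module_hom.add[OF Vector_Spaces.linear.axioms(3)[OF linear_E]]
lemmas E_scaleC = module_hom.scale[OF Vector_Spaces.linear.axioms(3)[OF linear_E]]

lemma continuous_on_E: "continuous_on S E"
proof -
  have "bounded_linear E"
    by (rule bounded_linear_intro[where K = 1])
      (simp_all add: E_add E_scaleC scaleR_scaleC norm_E_le)
  then show ?thesis
    by (simp add: linear_continuous_on)
qed

text \<open>Positivity of \<open>E\<close> enters here, through the self-adjointness of
  \<open>star y * y\<close>.\<close>

lemma star_E_square: "star (E (star x * x)) = E (star x * x)"
proof -
  have "positive_in B (E (star x * x))"
    by (rule E_positive) (auto simp: positive_in_def)
  then show ?thesis
    by (auto simp: positive_in_def star_mult star_star)
qed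

text \<open>
  Polarization together with the approximate unit shows that \<open>E\<close> preserves the involution, without
  decomposing self-adjoint elements into positive ones.
\<close>

lemma star_E_mult: "star (E (star x * y)) = E (star y * x)"
proof -
  \<comment> \<open>Expanding \<open>star_E_square\<close> at \<open>u + v\<close> and cancelling
    the squares leaves the mixed terms.\<close>
  have sum: "star (E (star v * u)) + star (E (star u * v)) = E (star v * u) + E (star u * v)" for u v
    using star_E_square[of "u + v"] star_E_square[of u] star_E_square[of v]
    by (simp add: star_add distrib_left distrib_right E_add)
  define p q where "p = E (star x * y)" and "q = E (star y * x)"
  \<comment> \<open>Putting \<open>\<i> *\<^sub>C y\<close> for \<open>y\<close> reverses the
    relative sign of the mixed terms. The resulting equation for the difference, added to the one
    for the sum, isolates \<open>star p\<close>.\<close>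
  have "star (\<i> *\<^sub>C p) + star ((- \<i>) *\<^sub>C q) = \<i> *\<^sub>C p + (- \<i>) *\<^sub>C q"
    using sum[of x "\<i> *\<^sub>C y"]
    by (simp add: star_scaleC mult_scaleC_left mult_scaleC_right E_scaleC p_def q_def
        del: complex_vector.scale_minus_left)
  then have "\<i> *\<^sub>C (star (\<i> *\<^sub>C p) + star ((- \<i>) *\<^sub>C q)) = \<i> *\<^sub>C (\<i> *\<^sub>C p + (- \<i>) *\<^sub>C q)"
    by simp
  then have "star p - star q = q - p"
    by (simp add: star_scaleC scaleC_add_right scaleC_scaleC star_minus
        complex_vector.scale_right_diff_distrib)
  moreover have "star p + star q = p + q"
    using sum[of y x] by (simp add: p_def q_def add.commute)
  ultimately have "(star p - star q) + (star p + star q) = (q - p) + (p + q)"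
    by simp
  then have "2 *\<^sub>R star p = 2 *\<^sub>R q"
    by (simp add: scaleR_2)
  then have "star p = q"
    by simp
  then show ?thesis
    by (simp add: p_def q_def)
qed

text \<open>With one factor in \<open>B\<close>, \<open>star_E_mult\<close> lets the bimodule
  property pull that factor out of \<open>E\<close>; the approximate unit then cancels it.\<close>

lemma star_E: "star (E x) = E (star x)"
proof (rule eq_if_mult_right_eq)
  fix b assume "b \<in> B"
  then show "star (E x) * b = E (star x) * b"
    using star_E_mult[of b x]
    by (simp add: E_mult_left E_mult_right star_mem star_mult star_star)
qed

end

section \<open>The virtual commutant attached to a normalizer\<close>

text \<open>A relation rather than a function, because one sum may have several representations;
  single-valuedness comes later from a norm estimate. The parameter \<open>e\<close> stands for
  \<open>E (star a)\<close>.\<close>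

inductive_set commutant_graph :: "'a::cstar_algebra set \<Rightarrow> 'a \<Rightarrow> 'a \<Rightarrow> ('a \<times> 'a) set"
  for B a e where
  gen: "b \<in> B \<Longrightarrow> c \<in> B \<Longrightarrow> d \<in> B \<Longrightarrow>
    (b * a * c * star a * d, b * a * c * e * d) \<in> commutant_graph B a e"
| add: "(x, s) \<in> commutant_graph B a e \<Longrightarrow> (y, t) \<in> commutant_graph B a e \<Longrightarrow>
    (x + y, s + t) \<in> commutant_graph B a e"

context expectation
begin

context
  fixes a assumes a: "a \<in> normalizer B"
begin

abbreviation (input) "G \<equiv> commutant_graph B a (E (star a))"

section \<open>Norm estimate and bimodule structure of the graph\<close>

lemma graph_fst_mem: "(x, s) \<in> G \<Longrightarrow> x \<in> B"
proof (induct rule: commutant_graph.induct)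
  case (gen b c d)
  have "b * (a * c * star a) * d \<in> B"
    using gen normalizerD(2)[OF a] by (blast intro: mult_mem)
  then show ?case
    by (simp add: mult.assoc)
qed (auto intro: add_mem)

text \<open>Membership of \<open>s\<close> in \<open>B\<close> is not yet known, but the factor
  \<open>star a\<close> on the left pairs with the \<open>a\<close> inside \<open>s\<close>, and the
  normalizer property applies.\<close>

lemma graph_star_mult_snd_mem: "(x, s) \<in> G \<Longrightarrow> b \<in> B \<Longrightarrow> star a * b * s \<in> B"
proof (induct rule: commutant_graph.induct)
  case (gen b' c d)
  have "(star a * (b * b') * a) * (c * E (star a) * d) \<in> B"
    using gen a by (intro mult_mem normalizerD E_mem)
  then show ?case
    by (simp add: mult.assoc)
qed (auto simp: distrib_left intro: add_mem)

text \<open>By the preceding lemma, \<open>star s' * b * a * c\<close> lies in \<open>B\<close> and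
  leaves \<open>E\<close>, as does \<open>d\<close> on the right. Only \<open>star a\<close> remains
  inside, which turns \<open>x\<close> into \<open>s\<close>.\<close>

lemma E_star_snd_mult_fst:
  assumes "(x', s') \<in> G"
  shows "(x, s) \<in> G \<Longrightarrow> E (star s' * x) = star s' * s"
proof (induct rule: commutant_graph.induct)
  case (gen b c d)
  have "star (star a * star b * s') \<in> B"
    using assms gen by (intro star_mem graph_star_mult_snd_mem)
  then have "star s' * b * a \<in> B"
    by (simp add: star_mult star_star mult.assoc)
  then have m: "star s' * b * a * c \<in> B"
    using gen(2) by (rule mult_mem)
  have "E ((star s' * b * a * c) * (star a * d)) = (star s' * b * a * c) * (E (star a) * d)"
    using gen by (simp only: E_mult_left[OF m] E_mult_right)
  then show ?case
    by (simp add: mult.assoc)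
qed (simp add: distrib_left E_add)

text \<open>Taking \<open>s' = s\<close> above expresses \<open>star s * s\<close> as
  \<open>E (star s * x)\<close>, and \<open>E\<close> is contractive.\<close>

lemma graph_norm_le:
  assumes "(x, s) \<in> G"
  shows "norm s \<le> norm x"
proof (cases "s = 0")
  case False
  have "norm s * norm s = norm (E (star s * x))"
    using assms by (simp add: E_star_snd_mult_fst cstar_identity flip: power2_eq_square)
  also have "\<dots> \<le> norm s * norm x"
    by (metis norm_E_le norm_mult_ineq norm_star order_trans)
  finally show ?thesis
    using False by simp
qed simp

lemma graph_scaleC: "(x, s) \<in> G \<Longrightarrow> (k *\<^sub>C x, k *\<^sub>C s) \<in> G"
proof (induct rule: commutant_graph.induct)
  case (gen b c d)
  then show ?case
    using commutant_graph.gen[OF scaleC_mem[OF gen(1), of k], of c d a "E (star a)"]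
    by (simp add: mult_scaleC_left)
qed (auto simp: scaleC_add_right intro: commutant_graph.add)

lemma graph_mult_left: "(x, s) \<in> G \<Longrightarrow> b \<in> B \<Longrightarrow> (b * x, b * s) \<in> G"
proof (induct rule: commutant_graph.induct)
  case (gen b' c d)
  then show ?case
    using commutant_graph.gen[OF mult_mem[of b b'], of c d a "E (star a)"]
    by (simp add: mult.assoc)
qed (auto simp: distrib_left intro: commutant_graph.add)

lemma graph_mult_right: "(x, s) \<in> G \<Longrightarrow> b \<in> B \<Longrightarrow> (x * b, s * b) \<in> G"
proof (induct rule: commutant_graph.induct)
  case (gen b' c d)
  then show ?case
    using commutant_graph.gen[OF gen(1,2) mult_mem[of d b], of a "E (star a)"]
    by (simp add: mult.assoc)
qed (auto simp: distrib_right intro: commutant_graph.add)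

section \<open>Passage to the closure of the graph\<close>

lemma closure_graph_fst_mem:
  assumes "(x, s) \<in> closure G"
  shows "x \<in> B"
proof -
  have "fst (x, s) \<in> closure B"
    by (rule map_in_closure[OF _ _ assms]) (auto intro: continuous_intros graph_fst_mem)
  then show ?thesis
    using closed_B by simp
qed

lemma closure_graph_norm_le:
  assumes "(x, s) \<in> closure G"
  shows "norm s \<le> norm x"
proof -
  have "closed {p :: 'a \<times> 'a. norm (snd p) \<le> norm (fst p)}"
    by (intro closed_Collect_le continuous_intros)
  then have "closure G \<subseteq> {p. norm (snd p) \<le> norm (fst p)}"
    by (rule closure_minimal[rotated]) (auto intro: graph_norm_le)
  then show ?thesis
    using assms by auto
qed

lemma closure_graph_add:
  assumes "(x, s) \<in> closure G" "(y, t) \<in> closure G"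
  shows "(x + y, s + t) \<in> closure G"
proof -
  have "(x, s) + (y, t) \<in> closure G"
    by (rule binop_in_closure[OF _ _ assms])
      (auto intro!: continuous_intros intro: commutant_graph.add)
  then show ?thesis
    by simp
qed

lemma closure_graph_scaleC:
  assumes "(x, s) \<in> closure G"
  shows "(k *\<^sub>C x, k *\<^sub>C s) \<in> closure G"
proof -
  have "(\<lambda>p. (k *\<^sub>C fst p, k *\<^sub>C snd p)) (x, s) \<in> closure G"
    by (rule map_in_closure[OF _ _ assms]) (auto intro!: continuous_intros intro: graph_scaleC)
  then show ?thesis
    by simp
qed

lemma closure_graph_mult_left:
  assumes "(x, s) \<in> closure G" "b \<in> B"
  shows "(b * x, b * s) \<in> closure G"
proof -
  have "(\<lambda>p. (b * fst p, b * snd p)) (x, s) \<in> closure G"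
    by (rule map_in_closure[OF _ _ assms(1)])
      (auto intro!: continuous_intros intro: graph_mult_left assms(2))
  then show ?thesis
    by simp
qed

lemma closure_graph_mult_right:
  assumes "(x, s) \<in> closure G" "b \<in> B"
  shows "(x * b, s * b) \<in> closure G"
proof -
  have "(\<lambda>p. (fst p * b, snd p * b)) (x, s) \<in> closure G"
    by (rule map_in_closure[OF _ _ assms(1)])
      (auto intro!: continuous_intros intro: graph_mult_right assms(2))
  then show ?thesis
    by simp
qed

text \<open>The norm bound is applied to the difference of the two pairs. It yields both
  single-valuedness and the Cauchy property below.\<close>

lemma closure_graph_dist_le:
  assumes "(x, s) \<in> closure G" "(y, t) \<in> closure G"
  shows "dist s t \<le> dist x y"
  using closure_graph_norm_le
      [OF closure_graph_add[OF assms(1) closure_graph_scaleC[OF assms(2), of "-1"]]]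
  by (simp add: dist_norm)

text \<open>A projection of a closed set need not be closed; here the second coordinates over a
  convergent sequence are Cauchy, so completeness supplies the missing limit.\<close>

lemma closed_domain: "closed (fst ` closure G)"
  unfolding closed_sequential_limits
proof (intro allI impI, elim conjE)
  fix X l assume "\<forall>n. X n \<in> fst ` closure G" and X: "X \<longlonglongrightarrow> l"
  then have "\<exists>s. (X n, s) \<in> closure G" for n
    by (metis imageE prod.collapse)
  then obtain S where S: "\<And>n. (X n, S n) \<in> closure G"
    by metis
  have "Cauchy S"
    unfolding Cauchy_def
  proof (intro allI impI)
    fix r :: real assume "r > 0"
    then obtain M where "\<forall>m\<ge>M. \<forall>n\<ge>M. dist (X m) (X n) < r"
      using LIMSEQ_imp_Cauchy[OF X] unfolding Cauchy_def by blast
    then show "\<exists>M. \<forall>m\<ge>M. \<forall>n\<ge>M. dist (S m) (S n) < r"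
      using closure_graph_dist_le[OF S S] by (meson le_less_trans)
  qed
  then obtain t where "S \<longlonglongrightarrow> t"
    using Cauchy_convergent_iff convergent_def by blast
  then have "(\<lambda>n. (X n, S n)) \<longlonglongrightarrow> (l, t)"
    using X by (intro tendsto_Pair)
  then have "(l, t) \<in> closure G"
    using closed_sequentially[OF closed_closure, of "\<lambda>n. (X n, S n)"] S by blast
  then show "l \<in> fst ` closure G"
    by force
qed

lemma virtual_commutant_closure_graph:
  obtains \<phi> where "virtual_commutant B (fst ` closure G) \<phi>"
    and "\<And>x s. (x, s) \<in> closure G \<Longrightarrow> \<phi> x = s"
proof -
  let ?J = "fst ` closure G"
  define \<phi> where "\<phi> x = (SOME s. (x, s) \<in> closure G)" for x
  have graph: "(x, \<phi> x) \<in> closure G" if "x \<in> ?J" for x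
    unfolding \<phi>_def using that by (auto intro: someI)
  have domain: "x \<in> ?J" if "(x, s) \<in> closure G" for x s
    using that by force
  \<comment> \<open>Two pairs with the same first coordinate have second coordinates at distance
    zero, so the choice in \<open>\<phi>\<close> is forced.\<close>
  have \<phi>_eq: "\<phi> x = s" if "(x, s) \<in> closure G" for x s
    using closure_graph_dist_le[OF that graph[of x]] that by force
  have "(0, 0) \<in> G"
    using commutant_graph.gen[OF zero_mem zero_mem zero_mem] by simp
  then have "(0, 0) \<in> closure G"
    using closure_subset by blast
  then have "0 \<in> ?J"
    by force
  moreover have "x + y \<in> ?J" "\<phi> (x + y) = \<phi> x + \<phi> y" if "x \<in> ?J" "y \<in> ?J" for x y
    using closure_graph_add[OF graph[OF that(1)] graph[OF that(2)]] domain \<phi>_eq by auto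
  moreover have "k *\<^sub>C x \<in> ?J" "\<phi> (k *\<^sub>C x) = k *\<^sub>C \<phi> x" if "x \<in> ?J" for k x
    using closure_graph_scaleC[OF graph[OF that]] domain \<phi>_eq by auto
  moreover have "b * x \<in> ?J" "\<phi> (b * x) = b * \<phi> x" if "b \<in> B" "x \<in> ?J" for b x
    using closure_graph_mult_left[OF graph[OF that(2)] that(1)] domain \<phi>_eq by auto
  moreover have "x * b \<in> ?J" "\<phi> (x * b) = \<phi> x * b" if "b \<in> B" "x \<in> ?J" for b x
    using closure_graph_mult_right[OF graph[OF that(2)] that(1)] domain \<phi>_eq by auto
  moreover have "?J \<subseteq> B"
    using closure_graph_fst_mem by auto
  ultimately have "virtual_commutant B ?J \<phi>"
    using closed_domain
    unfolding virtual_commutant_def closed_ideal_def complex_vector.subspace_def by simp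
  then show ?thesis
    using \<phi>_eq by (rule that)
qed

text \<open>The range hypothesis puts each generator's second coordinate in \<open>B\<close>; the
  approximate unit strips the outer and middle factors.\<close>

lemma normalizer_mult_E_star_mem:
  assumes "\<And>J \<phi>. virtual_commutant B J \<phi> \<Longrightarrow> \<phi> ` J \<subseteq> B"
  shows "a * E (star a) \<in> B"
proof -
  obtain \<phi> where \<phi>: "virtual_commutant B (fst ` closure G) \<phi>"
      "\<And>x s. (x, s) \<in> closure G \<Longrightarrow> \<phi> x = s"
    by (rule virtual_commutant_closure_graph) (rule that)
  show ?thesis
  proof (rule mult_mem_if_sandwich_mem)
    fix b c d assume "b \<in> B" "c \<in> B" "d \<in> B"
    then have "(b * a * c * star a * d, b * a * c * E (star a) * d) \<in> closure G"
      using commutant_graph.gen closure_subset by blast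
    then show "b * a * c * E (star a) * d \<in> B"
      using assms[OF \<phi>(1)] \<phi>(2) by (metis fst_conv image_eqI subsetD)
  qed
qed

end

end

section \<open>Uniqueness\<close>

theorem theorem12p3:
  fixes B :: "'a::cstar_algebra set"
  assumes "separable_space (euclidean :: 'a topology)"
    and "closed_star_subalgebra B"
    and "contains_approximate_unit B"
    and "\<And>J \<phi>. virtual_commutant B J \<phi> \<Longrightarrow> \<phi> ` J \<subseteq> B"
    and "generates (normalizer B)"
  shows "\<exists>\<^sub>\<le>\<^sub>1E. conditional_expectation B E"
proof (rule Uniq_I)
  fix E F assume E: "conditional_expectation B E" and F: "conditional_expectation B F"
  interpret E: expectation B E
    by unfold_locales (fact assms(2,3) E)+
  interpret F: expectation B F
    by unfold_locales (fact assms(2,3) F)+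
  have normalizer_eq: "E a = F a" if a: "a \<in> normalizer B" for a
  proof -
    have aE: "a * E (star a) \<in> B" and aF: "a * F (star a) \<in> B"
      using E.normalizer_mult_E_star_mem[OF a assms(4)]
        F.normalizer_mult_E_star_mem[OF a assms(4)]
      by blast+
    \<comment> \<open>Both expectations fix \<open>a * E (star a)\<close>, and both release its
      right factor, which lies in \<open>B\<close>.\<close>
    have "E a * E (star a) = F a * E (star a)"
      using E.E_ident[OF aE] F.E_ident[OF aE] by (simp add: E.E_mult_right F.E_mult_right E.E_mem)
    moreover have "E a * F (star a) = F a * F (star a)"
      using E.E_ident[OF aF] F.E_ident[OF aF] by (simp add: E.E_mult_right F.E_mult_right F.E_mem)
    \<comment> \<open>After expansion, the two equations cancel the four products in pairs.\<close>
    ultimately have "(E a - F a) * star (E a - F a) = 0"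
      by (simp add: star_diff E.star_E F.star_E algebra_simps)
    then have "star (E a - F a) = 0"
      using star_mult_self_eq_zero_iff[of "star (E a - F a)"] by (simp add: star_star)
    then show ?thesis
      by (metis eq_iff_diff_eq_0 star_star star_zero)
  qed
  have "E x = F x" if "x \<in> complex_vector.span (normalizer B)" for x
    using that
    by (induct rule: complex_vector.span_induct_alt)
      (simp_all add: E.E_add F.E_add E.E_scaleC F.E_scaleC E.E_ident F.E_ident E.zero_mem
        normalizer_eq)
  moreover have "closed {x. E x = F x}"
    by (intro closed_Collect_eq E.continuous_on_E F.continuous_on_E)
  ultimately have "closure (complex_vector.span (normalizer B)) \<subseteq> {x. E x = F x}"
    by (intro closure_minimal) auto
  then show "E = F"
    using generates_normalizer_imp_dense[OF assms(5)] by auto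
qed

end
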